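(* Let $n \ge 1$ be an integer and let $0 < \varepsilon < 1/2$. There does not exist a function $M : \{0,1\}^n \times \{0,1\}^n \to \{0,1\}$ that is a (seedless) $\varepsilon$-extracting merger. That is, for every function $M : \{0,1\}^n \times \{0,1\}^n \to \{0,1\}$ there is a somewhere-random source $(X_1,X_2)$ with $X_1,X_2$ both $\{0,1\}^n$-valued such that the distribution of $M(X_1,X_2)$ is not $\varepsilon$-close to the uniform distribution on $\{0,1\}$.
   Context: A pair $(X_1,X_2)$ of jointly distributed (possibly correlated) $\{0,1\}^n$-valued random variables is a (2-part) somewhere-random source if for some $i \in \{1,2\}$ the distribution of $X_i$ is uniform over $\{0,1\}^n$. A function $M : \{0,1\}^n \times \{0,1\}^n \to \{0,1\}$ is a seedless $\varepsilon$-extracting merger if for every 2-part somewhere-random source $(X_1,X_2)$, the distribution of $M(X_1,X_2)$ is $\varepsilon$-close to uniform on $\{0,1\}$. Two distributions are $\varepsilon$-close if their statistical (total variation) distance is at most $\varepsilon$. *)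

theory Defs
  imports "HOL-Probability.Probability"
begin

definition bitstrings :: "nat \<Rightarrow> bool list set" where
  "bitstrings n = {xs. length xs = n}"

definition statistical_distance :: "'a pmf \<Rightarrow> 'a pmf \<Rightarrow> real" where
  "statistical_distance p q = (SUP A. \<bar>measure_pmf.prob p A - measure_pmf.prob q A\<bar>)"

definition eps_close :: "real \<Rightarrow> 'a pmf \<Rightarrow> 'a pmf \<Rightarrow> bool" where
  "eps_close \<epsilon> p q \<longleftrightarrow> statistical_distance p q \<le> \<epsilon>"

text \<open>
  A pair of jointly distributed random variables is represented by its joint law; the laws of
  the two components are the marginals.
\<close>

definition somewhere_random :: "nat \<Rightarrow> (bool list \<times> bool list) pmf \<Rightarrow> bool" where
  "somewhere_random n X \<longleftrightarrow>
     set_pmf X \<subseteq> bitstrings n \<times> bitstrings n \<and>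
     (map_pmf fst X = pmf_of_set (bitstrings n) \<or> map_pmf snd X = pmf_of_set (bitstrings n))"

text \<open>
  Only the values of \<open>M\<close> on \<open>bitstrings n \<times> bitstrings n\<close> matter, since every source is
  supported there.
\<close>

definition extracting_merger :: "nat \<Rightarrow> real \<Rightarrow> (bool list \<times> bool list \<Rightarrow> bool) \<Rightarrow> bool" where
  "extracting_merger n \<epsilon> M \<longleftrightarrow>
     (\<forall>X. somewhere_random n X \<longrightarrow> eps_close \<epsilon> (map_pmf M X) (pmf_of_set UNIV))"

end

theory Submission
  imports Defs
begin

text \<open>
  Some source fixes the output bit. If every row \<open>x\<close> of \<open>M\<close> contains an entry \<open>M (x, f x) = True\<close>,
  take \<open>(U, f U)\<close> with \<open>U\<close> uniform. Otherwise some row \<open>x\<close> is constantly \<open>False\<close>; take \<open>(x, U)\<close>.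
  A fixed bit has distance \<open>1 / 2\<close> from a uniform one.
\<close>

lemma finite_bitstrings: "finite (bitstrings n)"
  using finite_lists_length_eq[of "UNIV :: bool set" n] by (simp add: bitstrings_def)

lemma bitstrings_nonempty: "bitstrings n \<noteq> {}"
  unfolding bitstrings_def using Ex_list_of_length[of n] by blast

text \<open>A real supremum dominates its terms only if they are bounded above; here differences of
  probabilities have absolute value at most \<open>1\<close>.\<close>

lemma abs_prob_diff_le_statistical_distance:
  "\<bar>measure_pmf.prob p A - measure_pmf.prob q A\<bar> \<le> statistical_distance p q"
  unfolding statistical_distance_def
proof (rule cSUP_upper[OF UNIV_I])
  have "\<bar>measure_pmf.prob p B - measure_pmf.prob q B\<bar> \<le> 1" for B
    using measure_pmf.prob_le_1[of p B] measure_pmf.prob_le_1[of q B]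
      measure_nonneg[of "measure_pmf p" B] measure_nonneg[of "measure_pmf q" B]
    by linarith
  then show "bdd_above (range (\<lambda>B. \<bar>measure_pmf.prob p B - measure_pmf.prob q B\<bar>))"
    by (rule bdd_aboveI2)
qed

text \<open>The event \<open>{c}\<close> tells the two laws apart: its probability is
  \<open>1\<close> under the point mass and \<open>1 / 2\<close> under the uniform bit.\<close>

lemma return_pmf_not_eps_close_uniform_bool:
  assumes "\<epsilon> < 1 / 2"
  shows "\<not> eps_close \<epsilon> (return_pmf c) (pmf_of_set (UNIV :: bool set))"
proof -
  have "measure_pmf.prob (pmf_of_set (UNIV :: bool set)) {c} = 1 / 2"
    by (simp add: measure_pmf_single)
  moreover have "measure_pmf.prob (return_pmf c) {c} = 1"
    by (simp add: measure_pmf_single)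
  ultimately have "1 / 2 \<le> statistical_distance (return_pmf c) (pmf_of_set UNIV)"
    using abs_prob_diff_le_statistical_distance[of "return_pmf c" "{c}" "pmf_of_set UNIV"] by simp
  with assms show ?thesis by (simp add: eps_close_def)
qed

lemma somewhere_random_source_fixing_bit:
  fixes M :: "bool list \<times> bool list \<Rightarrow> bool"
  shows "\<exists>X c. somewhere_random n X \<and> map_pmf M X = return_pmf c"
proof -
  let ?U = "pmf_of_set (bitstrings n)"
  have set_U: "set_pmf ?U = bitstrings n"
    by (rule set_pmf_of_set[OF bitstrings_nonempty finite_bitstrings])
  show ?thesis
  proof (cases "\<forall>x\<in>bitstrings n. \<exists>y\<in>bitstrings n. M (x, y)")
    case True
    then obtain f where f: "\<And>x. x \<in> bitstrings n \<Longrightarrow> f x \<in> bitstrings n \<and> M (x, f x)"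
      by metis
    let ?X = "map_pmf (\<lambda>x. (x, f x)) ?U"
    \<comment> \<open>The first marginal is \<open>?U\<close>, since \<open>fst\<close> undoes the
      pairing; the law of \<open>f x\<close> may be anything on \<open>bitstrings n\<close>.\<close>
    have "somewhere_random n ?X"
      using f by (auto simp: somewhere_random_def set_U map_pmf_comp)
    moreover have "map_pmf M ?X = map_pmf (\<lambda>_. True) ?U"
      \<comment> \<open>\<open>f\<close> is controlled only on \<open>bitstrings n\<close>, but
        agreement on the support of \<open>?U\<close> suffices.\<close>
      unfolding map_pmf_comp using f set_U by (intro map_pmf_cong) auto
    ultimately show ?thesis by (metis map_pmf_const)
  next
    case False
    then obtain x where x: "x \<in> bitstrings n" "\<And>y. y \<in> bitstrings n \<Longrightarrow> \<not> M (x, y)"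
      by blast
    let ?X = "map_pmf (Pair x) ?U"
    \<comment> \<open>Now the second marginal is uniform and the first is the point mass at
      \<open>x\<close>.\<close>
    have "somewhere_random n ?X"
      using x(1) by (auto simp: somewhere_random_def set_U map_pmf_comp)
    moreover have "map_pmf M ?X = map_pmf (\<lambda>_. False) ?U"
      unfolding map_pmf_comp using x(2) set_U by (intro map_pmf_cong) auto
    ultimately show ?thesis by (metis map_pmf_const)
  qed
qed

theorem theorem1:
  fixes n :: nat and \<epsilon> :: real
  assumes "n \<ge> 1" and "0 < \<epsilon>" and "\<epsilon> < 1 / 2"
  shows "(\<nexists>M. extracting_merger n \<epsilon> M) \<and>
    (\<forall>M :: bool list \<times> bool list \<Rightarrow> bool. \<exists>X. somewhere_random n X \<and>
       \<not> eps_close \<epsilon> (map_pmf M X) (pmf_of_set (UNIV :: bool set)))"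
proof -
  have "\<exists>X. somewhere_random n X \<and> \<not> eps_close \<epsilon> (map_pmf M X) (pmf_of_set UNIV)"
    for M :: "bool list \<times> bool list \<Rightarrow> bool"
    using somewhere_random_source_fixing_bit[of n M]
      return_pmf_not_eps_close_uniform_bool[OF assms(3)] by metis
  \<comment> \<open>Such a source is a counterexample to
    \<open>extracting_merger n \<epsilon> M\<close>, so the second conjunct yields the
    first.\<close>
  then show ?thesis unfolding extracting_merger_def by blast
qed

end
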